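(* There exists a mass problem $\mathcal{A}$ with $\mathcal{A}>_M 0'$ such that there is no noncomputable $f\in\omega^\omega$ with $\mathcal{B}_f\le_M\mathcal{A}$.
   Context: A mass problem is a subset of Baire space $\omega^\omega$. $\mathcal{A}\le_M\mathcal{B}$ iff there is a partial Turing functional $\Psi$ such that for every $f\in\mathcal{B}$, $\Psi(f)$ is defined and $\Psi(f)\in\mathcal{A}$; $\mathcal{A}<_M\mathcal{B}$ means $\mathcal{A}\le_M\mathcal{B}$ and $\mathcal{B}\not\le_M\mathcal{A}$. $0'=\{f\in\omega^\omega: f\text{ not computable}\}$. For $f\in\omega^\omega$, $\mathcal{B}_f=\{g\in\omega^\omega: g\not\le_T f\}$. *)

theory Defs
  imports Main
begin

type_synonym baire = "nat \<Rightarrow> nat"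

type_synonym mass_problem = "baire set"


section \<open>Turing functionals\<close>

text \<open>
  Kleene's schemata for partial recursive functions relative to a function \<open>f\<close>, which
  enters only through the code \<open>Query\<close>. Codes carry no arity: evaluation has no value where
  the argument list does not fit a schema. \<open>PrimRec\<close> recurses on, and \<open>Mu\<close> minimizes over, the
  first argument.
\<close>

datatype code =
    Zero
  | Succ
  | Query
  | Proj nat
  | Comp code "code list"
  | PrimRec code code
  | Mu code

text \<open>\<open>eval f e xs y\<close>: with \<open>f\<close> as external function, \<open>e\<close> halts on input \<open>xs\<close> with output \<open>y\<close>.\<close>

inductive eval :: "baire \<Rightarrow> code \<Rightarrow> nat list \<Rightarrow> nat \<Rightarrow> bool" for f :: baire where
  Zero: "eval f Zero xs 0"
| Succ: "eval f Succ [x] (Suc x)"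
| Query: "eval f Query [x] (f x)"
| Proj: "i < length xs \<Longrightarrow> eval f (Proj i) xs (xs ! i)"
| Comp: "list_all2 (\<lambda>g y. eval f g xs y) gs ys \<Longrightarrow> eval f h ys z \<Longrightarrow> eval f (Comp h gs) xs z"
| PrimRec_0: "eval f g xs y \<Longrightarrow> eval f (PrimRec g h) (0 # xs) y"
| PrimRec_Suc: "eval f (PrimRec g h) (n # xs) r \<Longrightarrow> eval f h (n # r # xs) y
    \<Longrightarrow> eval f (PrimRec g h) (Suc n # xs) y"
| Mu: "eval f g (n # xs) 0 \<Longrightarrow> (\<forall>m<n. \<exists>y. eval f g (m # xs) (Suc y)) \<Longrightarrow> eval f (Mu g) xs n"

lemma eval_deterministic: "eval f e xs y \<Longrightarrow> eval f e xs z \<Longrightarrow> y = z"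
proof (induction arbitrary: z rule: eval.induct)
  case (PrimRec_0 g xs y h)
  from PrimRec_0.prems have "eval f g xs z"
    by (cases rule: eval.cases) auto
  then show ?case
    by (rule PrimRec_0.IH)
next
  case (Comp xs gs ys h w)
  from Comp.prems obtain ys' where ys': "list_all2 (\<lambda>g y. eval f g xs y) gs ys'" "eval f h ys' z"
    by (cases rule: eval.cases) auto
  have "ys = ys'"
    using Comp.IH(1) ys'(1) by (auto simp: list_all2_conv_all_nth intro!: nth_equalityI)
  then show ?case
    using Comp.IH(2) ys'(2) by blast
next
  case (PrimRec_Suc g h n xs r y)
  from PrimRec_Suc.prems obtain r' where "eval f (PrimRec g h) (n # xs) r'" "eval f h (n # r' # xs) z"
    by (cases rule: eval.cases) auto
  then show ?case
    using PrimRec_Suc.IH by metis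
next
  case (Mu g n xs)
  from Mu.prems have z: "eval f g (z # xs) 0 \<and> (\<forall>m<z. \<exists>y. eval f g (m # xs) (Suc y))"
    by (cases rule: eval.cases) auto
  have "\<not> z < n"
    using z Mu.IH(2) by (metis nat.distinct(1))
  moreover have "\<not> n < z"
    using z Mu.IH(1) by (metis nat.distinct(1))
  ultimately show ?case
    by simp
qed (erule eval.cases; simp)+

text \<open>
  A partial Turing functional is a partial map on Baire space; \<open>\<Psi> f\<close> is defined iff the
  computation with external function \<open>f\<close> halts on every input.
\<close>

definition turing_functional :: "(baire \<Rightarrow> baire option) \<Rightarrow> bool" where
  "turing_functional \<Psi> \<longleftrightarrow> (\<exists>e. \<forall>f g. \<Psi> f = Some g \<longleftrightarrow> (\<forall>n. eval f e [n] (g n)))"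

lemma turing_functional_of_code:
  "\<exists>\<Psi>. turing_functional \<Psi> \<and> (\<forall>f g. \<Psi> f = Some g \<longleftrightarrow> (\<forall>n. eval f e [n] (g n)))"
proof -
  define \<Psi> where "\<Psi> f = (if \<exists>g. \<forall>n. eval f e [n] (g n)
      then Some (SOME g. \<forall>n. eval f e [n] (g n)) else None)" for f
  have "\<Psi> f = Some g \<longleftrightarrow> (\<forall>n. eval f e [n] (g n))" for f g
  proof
    assume "\<Psi> f = Some g"
    then show "\<forall>n. eval f e [n] (g n)"
      using someI_ex[of "\<lambda>g. \<forall>n. eval f e [n] (g n)"] by (auto simp: \<Psi>_def split: if_splits)
  next
    assume g: "\<forall>n. eval f e [n] (g n)"
    then have "\<forall>n. eval f e [n] ((SOME g. \<forall>n. eval f e [n] (g n)) n)"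
      by (rule someI[of "\<lambda>g. \<forall>n. eval f e [n] (g n)"])
    with g have "(SOME g. \<forall>n. eval f e [n] (g n)) = g"
      by (meson eval_deterministic ext)
    with g show "\<Psi> f = Some g"
      by (auto simp: \<Psi>_def)
  qed
  then show ?thesis
    unfolding turing_functional_def by blast
qed

definition turing_le :: "baire \<Rightarrow> baire \<Rightarrow> bool"  (infix "\<le>\<^sub>T" 50) where
  "f \<le>\<^sub>T g \<longleftrightarrow> (\<exists>\<Psi>. turing_functional \<Psi> \<and> \<Psi> g = Some f)"

primrec query_free :: "code \<Rightarrow> bool" where
  "query_free Zero \<longleftrightarrow> True"
| "query_free Succ \<longleftrightarrow> True"
| "query_free Query \<longleftrightarrow> False"
| "query_free (Proj i) \<longleftrightarrow> True"
| "query_free (Comp h gs) \<longleftrightarrow> query_free h \<and> list_all id (map query_free gs)"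
| "query_free (PrimRec g h) \<longleftrightarrow> query_free g \<and> query_free h"
| "query_free (Mu g) \<longleftrightarrow> query_free g"

text \<open>The external function \<open>\<lambda>_. 0\<close> is a dummy: a query-free code never consults it.\<close>

definition computable :: "baire \<Rightarrow> bool" where
  "computable f \<longleftrightarrow> (\<exists>e. query_free e \<and> (\<forall>n. eval (\<lambda>_. 0) e [n] (f n)))"


section \<open>Medvedev reducibility\<close>

definition medvedev_le :: "mass_problem \<Rightarrow> mass_problem \<Rightarrow> bool"  (infix "\<le>\<^sub>M" 50) where
  "\<A> \<le>\<^sub>M \<B> \<longleftrightarrow> (\<exists>\<Psi>. turing_functional \<Psi> \<and> (\<forall>f\<in>\<B>. \<exists>g\<in>\<A>. \<Psi> f = Some g))"

definition medvedev_less :: "mass_problem \<Rightarrow> mass_problem \<Rightarrow> bool"  (infix "<\<^sub>M" 50) where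
  "\<A> <\<^sub>M \<B> \<longleftrightarrow> \<A> \<le>\<^sub>M \<B> \<and> \<not> \<B> \<le>\<^sub>M \<A>"

definition noncomputables :: mass_problem where
  "noncomputables = {f. \<not> computable f}"

definition not_below :: "baire \<Rightarrow> mass_problem" where
  "not_below f = {g. \<not> g \<le>\<^sub>T f}"

end

theory Submission
  imports Defs "HOL-Library.Countable"
begin

text \<open>
  Take the noncomputable functions and remove, for the \<open>n\<close>-th functional, one noncomputable
  value \<open>r n\<close> that it takes on a noncomputable argument \<open>g\<close>, if there is one; then no functional
  reduces the remaining problem \<open>\<A>\<close> to \<open>0'\<close>. Choosing \<open>g\<close> above none of the earlier \<open>r i\<close>
  (cone avoidance) makes the removed functions pairwise Turing inequivalent. Hence for a
  noncomputable \<open>f\<close> at least one of \<open>f\<close> and \<open>f + 1\<close> lies in \<open>\<A>\<close>, and no functional maps this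
  element, which is below \<open>f\<close>, into \<open>\<B>\<^sub>f\<close>.
\<close>

section \<open>Turing reducibility via codes\<close>

lemma turing_le_iff: "f \<le>\<^sub>T g \<longleftrightarrow> (\<exists>e. \<forall>n. eval g e [n] (f n))"
  unfolding turing_le_def turing_functional_def
  using turing_functional_of_code[unfolded turing_functional_def] by metis

text \<open>Composition of reductions on codes: if \<open>c\<close> computes the oracle of
  \<open>e\<close> from a second oracle, \<open>subst_query c e\<close> runs \<open>e\<close>
  relative to that one. For query-free \<open>c\<close> no query remains.\<close>

primrec subst_query :: "code \<Rightarrow> code \<Rightarrow> code" where
  "subst_query c Zero = Zero"
| "subst_query c Succ = Succ"
| "subst_query c Query = c"
| "subst_query c (Proj i) = Proj i"
| "subst_query c (Comp h gs) = Comp (subst_query c h) (map (subst_query c) gs)"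
| "subst_query c (PrimRec g h) = PrimRec (subst_query c g) (subst_query c h)"
| "subst_query c (Mu g) = Mu (subst_query c g)"

lemma eval_subst_query:
  assumes "eval g e xs y" and c: "\<And>n. eval f c [n] (g n)"
  shows "eval f (subst_query c e) xs y"
  using assms(1)
proof (induction rule: eval.induct)
  case (Comp xs gs ys h z)
  then have "list_all2 (\<lambda>g y. eval f g xs y) (map (subst_query c) gs) ys"
    by (auto simp: list_all2_conv_all_nth)
  with Comp show ?case
    by (auto intro: eval.Comp)
qed (auto intro: eval.intros c)

lemma query_free_subst_query: "query_free c \<Longrightarrow> query_free (subst_query c e)"
  by (induction e) (auto simp: list_all_iff)

lemma turing_le_trans: "f \<le>\<^sub>T g \<Longrightarrow> g \<le>\<^sub>T h \<Longrightarrow> f \<le>\<^sub>T h"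
  unfolding turing_le_iff by (meson eval_subst_query)

lemma computable_if_turing_le: "f \<le>\<^sub>T g \<Longrightarrow> computable g \<Longrightarrow> computable f"
  unfolding turing_le_iff computable_def by (meson eval_subst_query query_free_subst_query)

lemma turing_le_Suc_comp: "(\<lambda>n. Suc (f n)) \<le>\<^sub>T f"
proof -
  have "eval f (Comp Succ [Query]) [n] (Suc (f n))" for n
    by (rule eval.Comp[where ys = "[f n]"]) (auto intro: eval.intros)
  then show ?thesis
    unfolding turing_le_iff by blast
qed

lemma turing_le_Suc_comp': "f \<le>\<^sub>T (\<lambda>n. Suc (f n))"
proof -
  \<comment> \<open>\<open>PrimRec Zero (Proj 0)\<close> is the predecessor: each recursion step
    returns its index.\<close>
  have "eval g (PrimRec Zero (Proj 0)) [n] (n - 1)" for g n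
  proof (induction n)
    case (Suc n)
    show ?case
      using eval.PrimRec_Suc[OF Suc.IH eval.Proj[where i = 0]] by simp
  qed (simp add: eval.intros)
  then have "eval (\<lambda>n. Suc (f n)) (Comp (PrimRec Zero (Proj 0)) [Query]) [n] (Suc (f n) - 1)" for n
    by (rule eval.Comp[where ys = "[Suc (f n)]", rotated]) (simp add: eval.Query[of "\<lambda>n. Suc (f n)"])
  then show ?thesis
    unfolding turing_le_iff by auto
qed

section \<open>Total computable functions of several arguments\<close>

text \<open>Codes carry no arity, so \<open>k\<close> fixes the length of the argument list; only
  the values of \<open>F\<close> on lists of this length matter.\<close>

definition tc :: "nat \<Rightarrow> (nat list \<Rightarrow> nat) \<Rightarrow> bool" where
  "tc k F \<longleftrightarrow> (\<exists>c. query_free c \<and> (\<forall>f xs. length xs = k \<longrightarrow> eval f c xs (F xs)))"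

lemma tc_cong: "tc k F \<Longrightarrow> (\<And>xs. length xs = k \<Longrightarrow> F xs = G xs) \<Longrightarrow> tc k G"
  unfolding tc_def by (metis (no_types, lifting))

lemma tc_nth: "i < k \<Longrightarrow> tc k (\<lambda>xs. xs ! i)"
  unfolding tc_def by (rule exI[of _ "Proj i"]) (auto intro: eval.Proj)

lemma tc_comp:
  assumes H: "tc (length Fs) H" and Fs: "\<And>F. F \<in> set Fs \<Longrightarrow> tc k F"
  shows "tc k (\<lambda>xs. H (map (\<lambda>F. F xs) Fs))"
proof -
  from H obtain h where h: "query_free h"
      "\<And>f xs. length xs = length Fs \<Longrightarrow> eval f h xs (H xs)"
    unfolding tc_def by blast
  from Fs obtain c where c: "\<And>F. F \<in> set Fs \<Longrightarrow>
      query_free (c F) \<and> (\<forall>f xs. length xs = k \<longrightarrow> eval f (c F) xs (F xs))"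
    unfolding tc_def by metis
  have "eval f (Comp h (map c Fs)) xs (H (map (\<lambda>F. F xs) Fs))" if "length xs = k" for f xs
    by (rule eval.Comp[where ys = "map (\<lambda>F. F xs) Fs"])
      (use h c that in \<open>auto simp: list_all2_conv_all_nth\<close>)
  moreover have "query_free (Comp h (map c Fs))"
    using h c by (auto simp: list_all_iff)
  ultimately show ?thesis
    unfolding tc_def by blast
qed

text \<open>Composition with the new argument list in a closed form \<open>A xs\<close>, typically
  built with \<open>drop\<close>, while \<open>Fs\<close> gives it entry by entry.\<close>

lemma tc_apply:
  assumes "tc k H" and "length Fs = k" and "\<And>F. F \<in> set Fs \<Longrightarrow> tc n F"
    and "\<And>xs. length xs = n \<Longrightarrow> map (\<lambda>F. F xs) Fs = A xs"
  shows "tc n (\<lambda>xs. H (A xs))"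
proof -
  have "tc n (\<lambda>xs. H (map (\<lambda>F. F xs) Fs))"
    by (rule tc_comp) (use assms in auto)
  then show ?thesis
    by (rule tc_cong) (simp add: assms(4))
qed

lemma map_nth_upt: "map (\<lambda>i. xs ! i) [m..<length xs] = drop m xs"
  by (rule nth_equalityI) auto

lemma tc_comp1: "tc 1 (\<lambda>xs. h (xs ! 0)) \<Longrightarrow> tc k F \<Longrightarrow> tc k (\<lambda>xs. h (F xs))"
  using tc_comp[of "[F]" "\<lambda>xs. h (xs ! 0)" k] by simp

lemma tc_comp2:
  "tc 2 (\<lambda>xs. h (xs ! 0) (xs ! 1)) \<Longrightarrow> tc k F \<Longrightarrow> tc k G \<Longrightarrow> tc k (\<lambda>xs. h (F xs) (G xs))"
  by (rule tc_apply[where k = 2 and Fs = "[F, G]" and A = "\<lambda>xs. [F xs, G xs]" and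
        H = "\<lambda>xs. h (xs ! 0) (xs ! 1)", simplified]) auto

lemma tc_Suc: "tc k F \<Longrightarrow> tc k (\<lambda>xs. Suc (F xs))"
proof (rule tc_comp1[where h = "Suc"])
  have "eval f Succ xs (Suc (xs ! 0))" if "length xs = 1" for f xs
    using that by (cases xs) (auto intro: eval.Succ)
  then show "tc 1 (\<lambda>xs. Suc (xs ! 0))"
    unfolding tc_def by (intro exI[of _ Succ]) auto
qed

lemma tc_const: "tc k (\<lambda>xs. n)"
proof (induction n)
  case 0
  show ?case
    unfolding tc_def by (rule exI[of _ Zero]) (auto intro: eval.Zero)
qed (rule tc_Suc)

lemma tc_rec_nat:
  assumes N: "tc k N" and G: "tc k G" and H: "tc (Suc (Suc k)) H"
  shows "tc k (\<lambda>xs. rec_nat (G xs) (\<lambda>m r. H (m # r # xs)) (N xs))"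
proof -
  from G obtain g where g: "query_free g" "\<And>f xs. length xs = k \<Longrightarrow> eval f g xs (G xs)"
    unfolding tc_def by blast
  from H obtain h where h: "query_free h" "\<And>f xs. length xs = Suc (Suc k) \<Longrightarrow> eval f h xs (H xs)"
    unfolding tc_def by blast
  have "eval f (PrimRec g h) (n # xs) (rec_nat (G xs) (\<lambda>m r. H (m # r # xs)) n)"
    if "length xs = k" for f n xs
    by (induction n) (use g h that in \<open>auto intro: eval.PrimRec_0 eval.PrimRec_Suc\<close>)
  then have "tc (Suc k) (\<lambda>xs. rec_nat (G (tl xs)) (\<lambda>m r. H (m # r # tl xs)) (hd xs))"
    unfolding tc_def using g(1) h(1) by (intro exI[of _ "PrimRec g h"]) (auto simp: length_Suc_conv)
  then have "tc (length (N # map (\<lambda>i xs. xs ! i) [0..<k]))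
      (\<lambda>xs. rec_nat (G (tl xs)) (\<lambda>m r. H (m # r # tl xs)) (hd xs))"
    by simp
  then have "tc k (\<lambda>xs. (\<lambda>xs. rec_nat (G (tl xs)) (\<lambda>m r. H (m # r # tl xs)) (hd xs))
      (map (\<lambda>F. F xs) (N # map (\<lambda>i xs. xs ! i) [0..<k])))"
    by (rule tc_comp) (use N in \<open>auto intro: tc_nth\<close>)
  then show ?thesis
    by (rule tc_cong) (auto simp: comp_def map_nth)
qed

text \<open>Case distinction as a recursion of length \<open>A xs\<close>: without a step the value
  is \<open>B xs\<close>, and every step overwrites it with \<open>C xs\<close>. The
  \<open>drop 2\<close> skips the counter and the previous value.\<close>

lemma tc_if_zero:
  assumes "tc k A" "tc k B" "tc k C"
  shows "tc k (\<lambda>xs. if A xs = 0 then B xs else C xs)"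
proof -
  have "tc (Suc (Suc k)) (\<lambda>xs. C (drop 2 xs))"
    by (rule tc_apply[OF assms(3), where Fs = "map (\<lambda>i xs. xs ! i) [2..<Suc (Suc k)]"])
      (auto intro: tc_nth simp: comp_def map_nth_upt[symmetric] simp del: upt_Suc)
  then have "tc k (\<lambda>xs. rec_nat (B xs) (\<lambda>m r. C (drop 2 (m # r # xs))) (A xs))"
    using assms by (intro tc_rec_nat)
  then show ?thesis
    by (rule tc_cong) (auto split: nat.splits simp: gr0_conv_Suc)
qed

lemma tc_rec_nat':
  assumes "tc 1 (\<lambda>xs. N (xs ! 0))" and "tc 2 (\<lambda>xs. h (xs ! 0) (xs ! 1))"
  shows "tc 1 (\<lambda>xs. rec_nat a h (N (xs ! 0)))"
proof -
  have "tc 1 (\<lambda>xs. rec_nat a (\<lambda>m r. (\<lambda>zs. h (zs ! 0) (zs ! 1)) (m # r # xs)) (N (xs ! 0)))"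
    by (intro tc_rec_nat assms(1) tc_const tc_comp2[OF assms(2)] tc_nth) auto
  then show ?thesis
    by simp
qed

lemma tc_pred: "tc k F \<Longrightarrow> tc k (\<lambda>xs. F xs - 1)"
proof (rule tc_comp1[where h = "\<lambda>n. n - 1"])
  have "tc 1 (\<lambda>xs. rec_nat 0 (\<lambda>m r. m) (xs ! 0))"
    by (intro tc_rec_nat' tc_nth) auto
  moreover have "rec_nat 0 (\<lambda>m r. m) n = n - 1" for n
    by (cases n) auto
  ultimately show "tc 1 (\<lambda>xs. xs ! 0 - 1)"
    by simp
qed

lemma tc_mod_2: "tc k F \<Longrightarrow> tc k (\<lambda>xs. F xs mod 2)"
proof (rule tc_comp1[where h = "\<lambda>n. n mod 2"])
  have "tc 1 (\<lambda>xs. rec_nat 0 (\<lambda>m r. if r = 0 then 1 else 0) (xs ! 0))"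
    by (intro tc_rec_nat' tc_if_zero tc_const tc_nth) auto
  moreover have "rec_nat 0 (\<lambda>m r. if r = 0 then 1 else 0) n = n mod 2" for n :: nat
    by (induction n) (simp_all, presburger)
  ultimately show "tc 1 (\<lambda>xs. xs ! 0 mod 2)"
    by simp
qed

lemma tc_div_2: "tc k F \<Longrightarrow> tc k (\<lambda>xs. F xs div 2)"
proof (rule tc_comp1[where h = "\<lambda>n. n div 2"])
  have "tc 1 (\<lambda>xs. rec_nat 0 (\<lambda>m r. if m mod 2 = 0 then r else Suc r) (xs ! 0))"
    by (intro tc_rec_nat' tc_if_zero tc_mod_2 tc_Suc tc_nth) auto
  moreover have "rec_nat 0 (\<lambda>m r. if m mod 2 = 0 then r else Suc r) n = n div 2" for n :: nat
    by (induction n) (simp_all, presburger)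
  ultimately show "tc 1 (\<lambda>xs. xs ! 0 div 2)"
    by simp
qed

section \<open>Evaluation with bounded minimization\<close>

text \<open>\<open>climb F k\<close> is the least \<open>n\<close> with \<open>F n \<le> 1\<close>, cut off at \<open>k\<close>.\<close>

primrec climb :: "(nat \<Rightarrow> nat) \<Rightarrow> nat \<Rightarrow> nat" where
  "climb F 0 = 0"
| "climb F (Suc k) = (if F (climb F k) - 1 = 0 then climb F k else Suc (climb F k))"

lemma climb_below: "j < climb F k \<Longrightarrow> 1 < F j"
  by (induction k) (auto split: if_splits simp: less_Suc_eq)

lemma climb_eq:
  assumes "\<And>j. j < n \<Longrightarrow> 1 < F j" and "F n \<le> 1" and "n \<le> k"
  shows "climb F k = n"
proof -
  have "climb F k = min k n"
  proof (induction k)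
    case (Suc k)
    then show ?case
      using assms(1)[of k] assms(2) by (cases k n rule: linorder_cases) (auto simp: min_def)
  qed simp
  with assms(3) show ?thesis
    by simp
qed

text \<open>The value \<open>Suc y\<close> stands for the output \<open>y\<close>, and \<open>0\<close> for "no output"; \<open>s\<close> bounds every
  minimization.\<close>

primrec ev :: "baire \<Rightarrow> nat \<Rightarrow> code \<Rightarrow> nat list \<Rightarrow> nat" where
  "ev q s Zero xs = 1"
| "ev q s Succ xs = (if length xs = 1 then Suc (Suc (xs ! 0)) else 0)"
| "ev q s Query xs = (if length xs = 1 then Suc (q (xs ! 0)) else 0)"
| "ev q s (Proj i) xs = (if i < length xs then Suc (xs ! i) else 0)"
| "ev q s (Comp h gs) xs = (if \<exists>y\<in>set (map (\<lambda>g. g xs) (map (ev q s) gs)). y = 0 then 0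
     else ev q s h (map (\<lambda>g. g xs - 1) (map (ev q s) gs)))"
| "ev q s (PrimRec g h) xs = (if xs = [] then 0
     else rec_nat (ev q s g (tl xs)) (\<lambda>m r. if r = 0 then 0 else ev q s h (m # (r - 1) # tl xs)) (hd xs))"
| "ev q s (Mu g) xs = (let n = climb (\<lambda>n. ev q s g (n # xs)) s in
     if ev q s g (n # xs) = 1 then Suc n else 0)"

lemma ev_PrimRec_Cons:
  "ev q s (PrimRec g h) (n # xs) =
    rec_nat (ev q s g xs) (\<lambda>m r. if r = 0 then 0 else ev q s h (m # (r - 1) # xs)) n"
  by (simp cong: if_cong)

declare ev.simps(6) [simp del] ev_PrimRec_Cons [simp]

text \<open>Soundness: a small bound can make \<open>ev\<close> give no output, but never a wrong
  one.\<close>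

lemma eval_if_ev: "ev q s e xs = Suc y \<Longrightarrow> eval q e xs y"
proof (induction e arbitrary: xs y)
  case Zero
  then show ?case by (auto intro: eval.intros)
next
  case Succ
  then show ?case by (cases xs) (auto intro: eval.intros split: if_splits)
next
  case Query
  then show ?case by (cases xs) (auto intro: eval.intros split: if_splits)
next
  case (Proj i)
  then show ?case by (auto intro: eval.intros split: if_splits)
next
  case (Comp h gs)
  from Comp.prems have nz: "\<And>g. g \<in> set gs \<Longrightarrow> ev q s g xs \<noteq> 0"
    and h: "ev q s h (map (\<lambda>g. ev q s g xs - 1) gs) = Suc y"
    by (auto split: if_splits simp: comp_def)
  have "eval q g xs (ev q s g xs - 1)" if "g \<in> set gs" for g
    using nz[OF that] by (intro Comp.IH(2) that) simp
  then have "list_all2 (\<lambda>g y. eval q g xs y) gs (map (\<lambda>g. ev q s g xs - 1) gs)"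
    by (auto simp: list_all2_conv_all_nth)
  with Comp.IH(1)[OF h] show ?case
    by (rule eval.Comp[rotated])
next
  case (PrimRec g h)
  let ?R = "\<lambda>zs. rec_nat (ev q s g zs) (\<lambda>m r. if r = 0 then 0 else ev q s h (m # (r - 1) # zs))"
  obtain n zs where xs: "xs = n # zs"
    using PrimRec.prems by (cases xs) (auto simp: ev.simps(6))
  have "?R zs n = Suc y \<Longrightarrow> eval q (PrimRec g h) (n # zs) y"
  proof (induction n arbitrary: y)
    case 0
    then show ?case by (auto intro: eval.PrimRec_0 PrimRec.IH)
  next
    case (Suc n)
    then obtain r where r: "?R zs n = Suc r"
      by (cases "?R zs n") auto
    with Suc show ?case
      by (auto intro: eval.PrimRec_Suc PrimRec.IH)
  qed
  with PrimRec.prems xs show ?case by simp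
next
  case (Mu g)
  let ?F = "\<lambda>n. ev q s g (n # xs)"
  \<comment> \<open>\<open>climb\<close> also stops where \<open>g\<close> gives no output or at the
    cutoff; the final test for 1 accepts only a true output 0.\<close>
  from Mu.prems have y: "y = climb ?F s" "?F y = 1"
    by (auto simp: Let_def split: if_splits)
  have "\<exists>z. eval q g (m # xs) (Suc z)" if "m < y" for m
  proof -
    have "1 < ?F m"
      using that y(1) climb_below by blast
    then have "?F m = Suc (Suc (?F m - 2))"
      by simp
    then show ?thesis
      using Mu.IH by blast
  qed
  with y(2) show ?case
    by (auto intro!: eval.Mu Mu.IH)
qed

text \<open>Completeness: a halting computation makes finitely many queries and minimizations, so
  \<open>ev\<close> reproduces it once the oracle is correct far enough and the bound is large. A
  filter intersects these finitely many conditions without explicit bounds.\<close>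

lemma eventually_ev:
  assumes "eval q e xs y"
    and query: "\<And>i. eventually (\<lambda>a. Q a i = q i) F"
    and bound: "\<And>n. eventually (\<lambda>a. n \<le> S a) F"
  shows "eventually (\<lambda>a. ev (Q a) (S a) e xs = Suc y) F"
  using assms(1)
proof (induction rule: eval.induct)
  case (Query x)
  show ?case
    using query[of x] by eventually_elim simp
next
  case (Comp xs gs ys h z)
  have len: "length gs = length ys"
    using Comp.IH(1) by (simp add: list_all2_lengthD)
  have "eventually (\<lambda>a. \<forall>i\<in>{..<length gs}. ev (Q a) (S a) (gs ! i) xs = Suc (ys ! i)) F"
    using Comp.IH(1) by (intro eventually_ball_finite) (auto simp: list_all2_conv_all_nth)
  with Comp.IH(2) show ?case
  proof eventually_elim
    case (elim a)
    then have "map (\<lambda>g. ev (Q a) (S a) g xs - 1) gs = ys"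
      using len by (auto intro: nth_equalityI)
    moreover have "\<forall>g\<in>set gs. ev (Q a) (S a) g xs \<noteq> 0"
      using elim by (auto simp: in_set_conv_nth)
    ultimately show ?case
      using elim by (auto simp: comp_def)
  qed
next
  case (PrimRec_Suc g h n xs r y)
  from PrimRec_Suc.IH show ?case
    by eventually_elim simp
next
  case (Mu g n xs)
  have "\<forall>m<n. \<exists>y. eventually (\<lambda>a. ev (Q a) (S a) g (m # xs) = Suc (Suc y)) F"
    using Mu.IH(2) by blast
  then have "eventually (\<lambda>a. 1 < ev (Q a) (S a) g (m # xs)) F" if "m < n" for m
    using that by (auto elim!: allE[of _ m] eventually_mono)
  then have "eventually (\<lambda>a. \<forall>m\<in>{..<n}. 1 < ev (Q a) (S a) g (m # xs)) F"
    by (intro eventually_ball_finite) auto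
  with Mu.IH(1) bound[of n] show ?case
  proof eventually_elim
    case (elim a)
    then have "climb (\<lambda>n. ev (Q a) (S a) g (n # xs)) (S a) = n"
      by (intro climb_eq) auto
    with elim show ?case
      by simp
  qed
qed auto

lemma ev_eq_if_eval:
  assumes "eval q e xs y"
  obtains u where "\<And>q' s. u \<le> s \<Longrightarrow> (\<forall>i<u. q' i = q i) \<Longrightarrow> ev q' s e xs = Suc y"
proof -
  \<comment> \<open>The sets \<open>N u\<close> shrink as \<open>u\<close> grows and so form a
    filter base: basic neighbourhoods of \<open>q\<close> paired with large bounds.\<close>
  define N where "N u = {(q', s). u \<le> s \<and> (\<forall>i<u. q' i = q i)}" for u :: nat
  define F where "F = (INF u. principal (N u))"
  have F: "eventually P F \<longleftrightarrow> (\<exists>u. \<forall>a\<in>N u. P a)" for P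
  proof -
    have "\<exists>w\<in>UNIV. principal (N w) \<le> inf (principal (N u)) (principal (N v))" for u v
      by (rule bexI[of _ "max u v"]) (auto simp: N_def)
    then show ?thesis
      unfolding F_def by (subst eventually_INF_base) (auto simp: eventually_principal)
  qed
  have "eventually (\<lambda>a. ev (fst a) (snd a) e xs = Suc y) F"
  proof (rule eventually_ev[OF assms])
    show "eventually (\<lambda>a. fst a i = q i) F" for i
      unfolding F by (rule exI[of _ "Suc i"]) (auto simp: N_def)
    show "eventually (\<lambda>a. n \<le> snd a) F" for n
      unfolding F by (rule exI[of _ n]) (auto simp: N_def)
  qed
  then obtain u where "\<forall>a\<in>N u. ev (fst a) (snd a) e xs = Suc y"
    unfolding F by blast
  then show thesis
    by (intro that[of u]) (auto simp: N_def)
qed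

text \<open>The use principle, obtained by passing to \<open>ev\<close> and back.\<close>

lemma eval_use:
  assumes "eval q e xs y"
  obtains u where "\<And>q'. (\<forall>i<u. q' i = q i) \<Longrightarrow> eval q' e xs y"
  using ev_eq_if_eval[OF assms] eval_if_ev by (metis order_refl)

section \<open>Computability of the bounded evaluator, and unbounded search\<close>

lemma tc_ex_zero:
  assumes "\<And>G. G \<in> set Gs \<Longrightarrow> tc k G" "tc k H"
  shows "tc k (\<lambda>xs. if \<exists>G\<in>set Gs. G xs = 0 then 0 else H xs)"
  using assms(1)
proof (induction Gs)
  case Nil
  show ?case using assms(2) by simp
next
  case (Cons G Gs)
  have "tc k (\<lambda>xs. if G xs = 0 then 0 else if \<exists>G\<in>set Gs. G xs = 0 then 0 else H xs)"
    using Cons by (intro tc_if_zero tc_const) auto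
  then show ?case
    by (rule tc_cong) auto
qed

text \<open>Induction on the fixed code \<open>e\<close>, with \<open>k\<close> arbitrary because
  subcodes run on lists of other lengths. The entry \<open>zs ! 0\<close> is both the index of the
  oracle and the bound, so that a single search variable controls both.\<close>

lemma tc_ev:
  assumes "tc 2 (\<lambda>xs. Q (xs ! 0) (xs ! 1))"
  shows "tc (Suc k) (\<lambda>zs. ev (Q (zs ! 0)) (zs ! 0) e (tl zs))"
proof (induction e arbitrary: k)
  case Zero
  show ?case by (simp add: tc_const)
next
  case Succ
  show ?case
  proof (cases "k = 1")
    case True
    have "tc (Suc k) (\<lambda>zs. Suc (Suc (zs ! 1)))"
      using True by (intro tc_Suc tc_nth) auto
    then show ?thesis
      by (rule tc_cong) (auto simp: True nth_tl)
  next
    case False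
    show ?thesis
      by (rule tc_cong[OF tc_const[of _ 0]]) (use False in auto)
  qed
next
  case Query
  show ?case
  proof (cases "k = 1")
    case True
    have "tc (Suc k) (\<lambda>zs. Suc (Q (zs ! 0) (zs ! 1)))"
      using True by (intro tc_Suc tc_comp2[OF assms] tc_nth) auto
    then show ?thesis
      by (rule tc_cong) (auto simp: True nth_tl)
  next
    case False
    show ?thesis
      by (rule tc_cong[OF tc_const[of _ 0]]) (use False in auto)
  qed
next
  case (Proj i)
  show ?case
  proof (cases "i < k")
    case True
    then have "tc (Suc k) (\<lambda>zs. Suc (zs ! Suc i))"
      by (intro tc_Suc tc_nth) auto
    then show ?thesis
      by (rule tc_cong) (auto simp: True nth_tl)
  next
    case False
    show ?thesis
      by (rule tc_cong[OF tc_const[of _ 0]]) (use False in auto)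
  qed
next
  case (Comp h gs)
  let ?E = "\<lambda>e zs. ev (Q (zs ! 0)) (zs ! 0) e (tl zs)"
  have "tc (Suc k) (\<lambda>zs. ?E h (zs ! 0 # map (\<lambda>g. ?E g zs - 1) gs))"
    by (rule tc_apply[OF Comp.IH(1)[of "length gs"],
        where Fs = "(\<lambda>zs. zs ! 0) # map (\<lambda>g zs. ?E g zs - 1) gs"])
      (auto intro!: tc_nth tc_pred[unfolded One_nat_def] Comp.IH(2))
  then have "tc (Suc k) (\<lambda>zs. if \<exists>G\<in>set (map ?E gs). G zs = 0 then 0
      else ?E h (zs ! 0 # map (\<lambda>g. ?E g zs - 1) gs))"
    by (intro tc_ex_zero) (auto intro: Comp.IH(2))
  then show ?case
    by (rule tc_cong) (auto simp: comp_def)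
next
  case (PrimRec g h)
  let ?E = "\<lambda>e zs. ev (Q (zs ! 0)) (zs ! 0) e (tl zs)"
  show ?case
  proof (cases k)
    case 0
    show ?thesis
      by (rule tc_cong[OF tc_const[of _ 0]]) (use 0 in \<open>auto simp: ev.simps(6) length_Suc_conv\<close>)
  next
    case (Suc k')
    have G: "tc (Suc k) (\<lambda>zs. ?E g (zs ! 0 # drop 2 zs))"
      by (rule tc_apply[OF PrimRec.IH(1)[of k'], where Fs = "map (\<lambda>i zs. zs ! i) (0 # [2..<Suc k])"])
        (auto intro: tc_nth simp: Suc comp_def map_nth_upt[symmetric] simp del: upt_Suc)
    \<comment> \<open>Here \<open>zs\<close> is \<open>m # r # t # n # ys\<close>: counter, encoded
      previous value, stage, recursion argument, remaining arguments.\<close>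
    have "tc (Suc (Suc (Suc k))) (\<lambda>zs. ?E h (zs ! 2 # zs ! 0 # (zs ! 1 - 1) # drop 4 zs))"
      by (rule tc_apply[OF PrimRec.IH(2)[of "Suc (Suc k')"],
          where Fs = "(\<lambda>zs. zs ! 2) # (\<lambda>zs. zs ! 0) # (\<lambda>zs. zs ! 1 - 1) #
            map (\<lambda>i zs. zs ! i) [4..<Suc (Suc (Suc k))]"])
        (auto intro: tc_nth tc_pred[unfolded One_nat_def] simp: Suc comp_def map_nth_upt[symmetric] simp del: upt_Suc)
    then have "tc (Suc (Suc (Suc k))) (\<lambda>zs. if zs ! 1 = 0 then 0
        else ?E h (zs ! 2 # zs ! 0 # (zs ! 1 - 1) # drop 4 zs))"
      by (intro tc_if_zero tc_const tc_nth) auto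
    then have "tc (Suc k) (\<lambda>zs. rec_nat (?E g (zs ! 0 # drop 2 zs)) (\<lambda>m r. (\<lambda>zs. if zs ! 1 = 0 then 0
        else ?E h (zs ! 2 # zs ! 0 # (zs ! 1 - 1) # drop 4 zs)) (m # r # zs)) (zs ! 1))"
      using G Suc by (intro tc_rec_nat tc_nth) auto
    then show ?thesis
    proof (rule tc_cong)
      fix zs :: "nat list"
      assume "length zs = Suc k"
      then obtain t n ys where "zs = t # n # ys"
        using Suc by (auto simp: length_Suc_conv)
      then show "rec_nat (?E g (zs ! 0 # drop 2 zs)) (\<lambda>m r. (\<lambda>zs. if zs ! 1 = 0 then 0
        else ?E h (zs ! 2 # zs ! 0 # (zs ! 1 - 1) # drop 4 zs)) (m # r # zs)) (zs ! 1)
        = ?E (PrimRec g h) zs"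
        by (simp cong: if_cong)
    qed
  qed
next
  case (Mu g)
  let ?E = "\<lambda>e zs. ev (Q (zs ! 0)) (zs ! 0) e (tl zs)"
  let ?N = "\<lambda>zs. climb (\<lambda>n. ev (Q (zs ! 0)) (zs ! 0) g (n # tl zs)) (zs ! 0)"
  have g: "tc n (\<lambda>zs. ?E g (T zs # R zs # drop m zs))"
    if "tc n T" "tc n R" "n = k + m" for T R m n
    by (rule tc_apply[OF Mu.IH[of "Suc k"], where Fs = "T # R # map (\<lambda>i zs. zs ! i) [m..<n]"])
      (use that in \<open>auto intro: tc_nth simp: comp_def map_nth_upt[symmetric] simp del: upt_Suc\<close>)
  \<comment> \<open>One step of \<open>climb\<close>: here \<open>zs\<close> is
    \<open>m # r # t # xs\<close> with current candidate \<open>r\<close> and stage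
    \<open>t\<close>.\<close>
  have "tc (Suc (Suc (Suc k))) (\<lambda>zs. if ?E g (zs ! 2 # zs ! 1 # drop 3 zs) - 1 = 0 then zs ! 1 else Suc (zs ! 1))"
    by (intro tc_if_zero tc_Suc tc_pred tc_nth g) auto
  then have "tc (Suc k) (\<lambda>zs. rec_nat 0 (\<lambda>m r. (\<lambda>zs. if ?E g (zs ! 2 # zs ! 1 # drop 3 zs) - 1 = 0
      then zs ! 1 else Suc (zs ! 1)) (m # r # zs)) (zs ! 0))"
    by (intro tc_rec_nat tc_nth tc_const) auto
  then have N: "tc (Suc k) ?N"
  proof (rule tc_cong)
    fix zs :: "nat list"
    assume "length zs = Suc k"
    have "rec_nat 0 (\<lambda>m r. (\<lambda>zs. if ?E g (zs ! 2 # zs ! 1 # drop 3 zs) - 1 = 0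
      then zs ! 1 else Suc (zs ! 1)) (m # r # zs)) s = climb (\<lambda>n. ev (Q (zs ! 0)) (zs ! 0) g (n # tl zs)) s" for s
      by (induction s) (auto simp: drop_Suc)
    then show "rec_nat 0 (\<lambda>m r. (\<lambda>zs. if ?E g (zs ! 2 # zs ! 1 # drop 3 zs) - 1 = 0
      then zs ! 1 else Suc (zs ! 1)) (m # r # zs)) (zs ! 0) = ?N zs" .
  qed
  have "tc (Suc k) (\<lambda>zs. if ?E g (zs ! 0 # ?N zs # drop 1 zs) = 0 then 0
      else if ?E g (zs ! 0 # ?N zs # drop 1 zs) - 1 = 0 then Suc (?N zs) else 0)"
    by (intro tc_if_zero tc_const tc_Suc tc_pred g N tc_nth) auto
  then show ?case
    by (rule tc_cong) (auto simp: Let_def drop_Suc)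
qed

text \<open>Minimization finds the first \<open>t\<close> at which \<open>T\<close> has an entry for
  \<open>n\<close>; by \<open>unique\<close> that entry is the right value.\<close>

lemma computable_by_search:
  assumes T: "tc 2 (\<lambda>xs. T (xs ! 0) (xs ! 1))"
    and ex: "\<And>n. \<exists>t. T t n \<noteq> 0"
    and unique: "\<And>t n y. T t n = Suc y \<Longrightarrow> y = x n"
  shows "computable x"
proof -
  \<comment> \<open>The flag is 0 at an entry because \<open>Mu\<close> looks for a zero; the second
    function decodes \<open>Suc y\<close> to \<open>y\<close>.\<close>
  have "tc 2 (\<lambda>xs. if T (xs ! 0) (xs ! 1) = 0 then 1 else 0)" "tc 2 (\<lambda>xs. T (xs ! 0) (xs ! 1) - 1)"
    by (intro tc_if_zero tc_const tc_pred T)+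
  then obtain c d where c: "query_free c"
      "\<And>f xs. length xs = 2 \<Longrightarrow> eval f c xs (if T (xs ! 0) (xs ! 1) = 0 then 1 else 0)"
    and d: "query_free d" "\<And>f xs. length xs = 2 \<Longrightarrow> eval f d xs (T (xs ! 0) (xs ! 1) - 1)"
    unfolding tc_def by auto
  have "eval f (Comp d [Mu c, Proj 0]) [n] (x n)" for f n
  proof -
    define t where "t = (LEAST t. T t n \<noteq> 0)"
    have t: "T t n \<noteq> 0"
      unfolding t_def by (rule LeastI_ex[OF ex])
    have below: "T m n = 0" if "m < t" for m
      using not_less_Least[OF that[unfolded t_def]] by simp
    have "eval f (Mu c) [n] t"
    proof (rule eval.Mu)
      show "eval f c [t, n] 0"
        using c(2)[of "[t, n]" f] t by simp
      have "eval f c [m, n] (Suc 0)" if "m < t" for m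
        using c(2)[of "[m, n]" f] below[OF that] by simp
      then show "\<forall>m<t. \<exists>y. eval f c [m, n] (Suc y)"
        by blast
    qed
    moreover have "eval f (Proj 0) [n] n"
      using eval.Proj[of 0 "[n]" f] by simp
    moreover have "eval f d [t, n] (x n)"
      using d(2)[of "[t, n]" f] unique[of t n "T t n - 1"] t by simp
    ultimately show ?thesis
      by (intro eval.Comp[where ys = "[t, n]"]) auto
  qed
  moreover have "query_free (Comp d [Mu c, Proj 0])"
    using c d by simp
  ultimately show ?thesis
    unfolding computable_def by blast
qed

section \<open>Cone avoidance\<close>

text \<open>A new lowest digit shifts the others up and keeps the number at least \<open>s\<close>.
  Arbitrarily large \<open>t\<close> are wanted because \<open>t\<close> will also bound
  minimizations.\<close>

lemma ex_bits: "\<exists>t\<ge>s. \<forall>i<u. odd (t div 2 ^ i) = q i" for s :: nat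
proof (induction u arbitrary: q)
  case (Suc u)
  obtain t where t: "s \<le> t" "\<forall>i<u. odd (t div 2 ^ i) = q (Suc i)"
    using Suc[of "\<lambda>i. q (Suc i)"] by blast
  have "odd ((of_bool (q 0) + 2 * t) div 2 ^ i) = q i" if "i < Suc u" for i
    using that t(2) by (cases i) (auto simp: div_mult2_eq)
  moreover have "s \<le> of_bool (q 0) + 2 * t"
    using t(1) by simp
  ultimately show ?case by blast
qed auto

text \<open>A computable dense sequence in the cylinder of the first \<open>m\<close> bits of \<open>p\<close>.\<close>

lemma ex_computable_dense_sequence:
  fixes p :: "nat \<Rightarrow> bool"
  shows "\<exists>L. tc 2 (\<lambda>xs. of_bool (L (xs ! 0) (xs ! 1))) \<and> (\<forall>t. \<forall>i<m. L t i = p i) \<and>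
    (\<forall>q u s. (\<forall>i<m. q i = p i) \<longrightarrow> (\<exists>t\<ge>s. \<forall>i<u. L t i = q i))"
proof (induction m arbitrary: p)
  case 0
  let ?L = "\<lambda>t i. odd ((t::nat) div 2 ^ i)"
  have "tc 2 (\<lambda>xs. rec_nat (xs ! 0) (\<lambda>m r. (\<lambda>zs. zs ! 1 div 2) (m # r # xs)) (xs ! 1) mod 2)"
    by (intro tc_mod_2 tc_rec_nat tc_div_2 tc_nth) auto
  moreover have "rec_nat t (\<lambda>m r. r div 2) i = t div 2 ^ i" for t i :: nat
    by (induction i) (simp_all add: power_Suc2 div_mult2_eq del: power_Suc)
  ultimately have "tc 2 (\<lambda>xs. of_bool (?L (xs ! 0) (xs ! 1)))"
    by (simp add: mod_2_eq_odd)
  then show ?case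
    using ex_bits by (intro exI[of _ ?L] conjI) auto
next
  case (Suc m)
  obtain L where L: "tc 2 (\<lambda>xs. of_bool (L (xs ! 0) (xs ! 1)))" "\<forall>t. \<forall>i<m. L t i = p (Suc i)"
    "\<forall>q u s. (\<forall>i<m. q i = p (Suc i)) \<longrightarrow> (\<exists>t\<ge>s. \<forall>i<u. L t i = q i)"
    using Suc[of "\<lambda>i. p (Suc i)"] by (elim exE conjE) (rule that)
  \<comment> \<open>The bit \<open>p 0\<close> enters the code as a constant, so \<open>p\<close>
    may be any sequence.\<close>
  define L' where "L' t i = (case i of 0 \<Rightarrow> p 0 | Suc j \<Rightarrow> L t j)" for t i
  have "tc 2 (\<lambda>xs. if xs ! 1 = 0 then of_bool (p 0) else of_bool (L (xs ! 0) (xs ! 1 - 1)))"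
    by (intro tc_if_zero tc_const tc_comp2[where h = "\<lambda>t i. of_bool (L t i)", OF L(1)] tc_pred tc_nth) auto
  then have "tc 2 (\<lambda>xs. of_bool (L' (xs ! 0) (xs ! 1)))"
    by (rule tc_cong) (auto simp: L'_def split: nat.split)
  moreover have "\<forall>t. \<forall>i<Suc m. L' t i = p i"
    using L(2) by (auto simp: L'_def split: nat.split)
  moreover have "\<exists>t\<ge>s. \<forall>i<u. L' t i = q i" if "\<forall>i<Suc m. q i = p i" for q u s
  proof -
    obtain t where "s \<le> t" "\<forall>i<u. L t i = q (Suc i)"
      using L(3)[rule_format, of "\<lambda>i. q (Suc i)" s u] \<open>\<forall>i<Suc m. q i = p i\<close> by auto
    then show ?thesis
      using that by (intro exI[of _ t]) (auto simp: L'_def split: nat.split)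
  qed
  ultimately show ?case
    by (intro exI[of _ L'] conjI) auto
qed

abbreviation char_fun :: "(nat \<Rightarrow> bool) \<Rightarrow> baire" where
  "char_fun q \<equiv> \<lambda>i. of_bool (q i)"

text \<open>If the sequences computing \<open>x\<close> through \<open>c\<close> were dense in the cylinder of the first \<open>m\<close> bits
  of \<open>p\<close>, every convergent computation from a sequence in this cylinder would give the right
  value of \<open>x\<close>, so a search would compute \<open>x\<close>.\<close>

lemma ex_extension_not_computing:
  assumes "\<not> computable x"
  shows "\<exists>p' m'. m \<le> m' \<and> (\<forall>i<m. p' i = p i) \<and>
    (\<forall>q. (\<forall>i<m'. q i = p' i) \<longrightarrow> \<not> (\<forall>n. eval (char_fun q) c [n] (x n)))"
proof (rule ccontr)
  assume no_extension: "\<not> ?thesis"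
  have dense: "\<exists>q. (\<forall>i<m'. q i = p' i) \<and> (\<forall>n. eval (char_fun q) c [n] (x n))"
    if "m \<le> m'" "\<forall>i<m. p' i = p i" for p' m'
  proof -
    have "\<not> (m \<le> m' \<and> (\<forall>i<m. p' i = p i) \<and>
        (\<forall>q. (\<forall>i<m'. q i = p' i) \<longrightarrow> \<not> (\<forall>n. eval (char_fun q) c [n] (x n))))"
      by (rule no_extension[unfolded not_ex, rule_format])
    with that show ?thesis by auto
  qed
  obtain L where L: "tc 2 (\<lambda>xs. of_bool (L (xs ! 0) (xs ! 1)))" "\<forall>t. \<forall>i<m. L t i = p i"
    "\<forall>q u s. (\<forall>i<m. q i = p i) \<longrightarrow> (\<exists>t\<ge>s. \<forall>i<u. L t i = q i)"
    using ex_computable_dense_sequence[of m p] by (elim exE conjE) (rule that)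
  \<comment> \<open>The index \<open>t\<close> selects the oracle \<open>L t\<close> and also bounds
    its computation.\<close>
  define T where "T t n = ev (char_fun (L t)) t c [n]" for t n
  have "computable x"
  proof (rule computable_by_search)
    have "tc (Suc 1) (\<lambda>zs. ev (char_fun (L (zs ! 0))) (zs ! 0) c (tl zs))"
      by (rule tc_ev) (rule L(1))
    then have "tc 2 (\<lambda>zs. ev (char_fun (L (zs ! 0))) (zs ! 0) c (tl zs))"
      by (simp add: numeral_2_eq_2)
    then show "tc 2 (\<lambda>xs. T (xs ! 0) (xs ! 1))"
      by (rule tc_cong) (auto simp: T_def numeral_2_eq_2 length_Suc_conv)
  next
    fix n
    \<comment> \<open>Existence: some \<open>q\<close> in the cylinder computes \<open>x\<close>; at
      \<open>n\<close> it uses a finite part of the oracle, which some \<open>L t\<close> with large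
      \<open>t\<close> shares.\<close>
    obtain q where q: "\<forall>i<m. q i = p i" "eval (char_fun q) c [n] (x n)"
      using dense[of m p] by auto
    from q(2) obtain u where u: "\<And>q' s. u \<le> s \<Longrightarrow> (\<forall>i<u. q' i = char_fun q i) \<Longrightarrow> ev q' s c [n] = Suc (x n)"
      by (rule ev_eq_if_eval) blast
    obtain t where "u \<le> t" "\<forall>i<u. L t i = q i"
      using L(3) q(1) by blast
    then have "T t n = Suc (x n)"
      unfolding T_def by (intro u) auto
    then show "\<exists>t. T t n \<noteq> 0"
      by (intro exI[of _ t]) simp
  next
    fix t n y
    assume "T t n = Suc y"
    then have "eval (char_fun (L t)) c [n] y"
      unfolding T_def by (rule eval_if_ev)
    then obtain u where u: "\<And>q'. (\<forall>i<u. q' i = char_fun (L t) i) \<Longrightarrow> eval q' c [n] y"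
      by (rule eval_use) blast
    \<comment> \<open>Correctness: the used part of \<open>L t\<close> extends to an oracle
      computing \<open>x\<close>, so the outputs agree. The \<open>max\<close> keeps the new
      cylinder inside the given one.\<close>
    obtain q where q: "\<forall>i<max m u. q i = L t i" "\<forall>n. eval (char_fun q) c [n] (x n)"
      using dense[of "max m u" "L t"] L(2) by auto
    have "eval (char_fun q) c [n] y"
      using q(1) by (intro u) auto
    with q(2) show "y = x n"
      using eval_deterministic by blast
  qed
  with assms show False by contradiction
qed

text \<open>Finite extension: a pair \<open>(p, m)\<close> stands for the cylinder of the first
  \<open>m\<close> values of \<open>p\<close>, and nested cylinders secure the requirements one by
  one.\<close>

lemma baire_category:
  fixes R :: "nat \<Rightarrow> (nat \<Rightarrow> 'a) \<Rightarrow> bool"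
  assumes dense: "\<And>k p m. \<exists>p' m'. m \<le> m' \<and> (\<forall>i<m. p' i = p i) \<and>
    (\<forall>q. (\<forall>i<m'. q i = p' i) \<longrightarrow> R k q)"
  shows "\<exists>q. \<forall>k. R k q"
proof -
  let ?step = "\<lambda>k s s'. snd s < snd s' \<and> (\<forall>i<snd s. fst s' i = fst s i) \<and>
    (\<forall>q. (\<forall>i<snd s'. q i = fst s' i) \<longrightarrow> R k q)"
  have "\<exists>s'. ?step k s s'" for k s
  proof -
    obtain p' m' where "snd s \<le> m'" "\<forall>i<snd s. p' i = fst s i" "\<forall>q. (\<forall>i<m'. q i = p' i) \<longrightarrow> R k q"
      using dense[where m = "snd s" and p = "fst s"] by blast
    then show ?thesis
      \<comment> \<open>\<open>Suc m'\<close> makes the lengths strictly increase, so every position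
        gets fixed.\<close>
      by (intro exI[of _ "(p', Suc m')"]) auto
  qed
  then have "\<exists>f. \<forall>k. True \<and> ?step k (f k) (f (Suc k))"
    by (intro dependent_nat_choice) auto
  then obtain f where f: "\<And>k. ?step k (f k) (f (Suc k))"
    by blast
  have len: "k \<le> snd (f k)" for k
  proof (induction k)
    case (Suc k)
    then show ?case using f[of k] by linarith
  qed simp
  have mono: "snd (f k) \<le> snd (f l) \<and> (\<forall>i<snd (f k). fst (f l) i = fst (f k) i)" if "k \<le> l" for k l
    using that
  proof (induction rule: dec_induct)
    case (step l)
    then show ?case using f[of l] by auto
  qed simp
  \<comment> \<open>The cylinder \<open>f (Suc i)\<close> has length above \<open>i\<close>, so its
    value at \<open>i\<close> is final.\<close>
  define q where "q i = fst (f (Suc i)) i" for i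
  have "q i = fst (f k) i" if "i < snd (f k)" for i k
    using that len[of "Suc i"] mono[of k "Suc i"] mono[of "Suc i" k] unfolding q_def
    by (cases "k \<le> Suc i") auto
  then show ?thesis
    using f by blast
qed

instance code :: countable
  by countable_datatype

lemma ex_noncomputable_avoiding_cones:
  fixes x :: "nat \<Rightarrow> baire"
  assumes x: "\<And>i. i < n \<Longrightarrow> \<not> computable (x i)"
  obtains g where "\<not> computable g" "\<And>i. i < n \<Longrightarrow> \<not> x i \<le>\<^sub>T g"
proof -
  \<comment> \<open>Requirement \<open>(c, 0)\<close> keeps \<open>c\<close> from computing
    \<open>q\<close>; requirement \<open>(c, Suc i)\<close> keeps \<open>c\<close> from computing
    \<open>x i\<close> from \<open>q\<close>. Each can be met by extending a finite prefix.\<close>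
  define S where "S k q = (case from_nat k of
      (c, 0) \<Rightarrow> \<not> (\<forall>j. eval (\<lambda>_. 0) c [j] (char_fun q j))
    | (c, Suc i) \<Rightarrow> i < n \<longrightarrow> \<not> (\<forall>j. eval (char_fun q) c [j] (x i j)))" for k q
  have "\<exists>p' m'. m \<le> m' \<and> (\<forall>i<m. p' i = p i) \<and> (\<forall>q. (\<forall>i<m'. q i = p' i) \<longrightarrow> S k q)" for k p m
  proof -
    obtain c l where k: "from_nat k = (c :: code, l :: nat)"
      by force
    show ?thesis
    proof (cases l)
      case 0
      \<comment> \<open>Diagonalization: position \<open>m\<close> gets 0 if \<open>c\<close>
        outputs 1 there, and 1 otherwise.\<close>
      let ?b = "\<not> eval (\<lambda>_. 0) c [m] 1"
      have "\<not> (\<forall>j. eval (\<lambda>_. 0) c [j] (char_fun q j))" if "q m = ?b" for q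
      proof
        assume "\<forall>j. eval (\<lambda>_. 0) c [j] (char_fun q j)"
        from this[THEN spec, of m] that show False
          using eval_deterministic by (cases "q m") fastforce+
      qed
      then show ?thesis
        by (intro exI[of _ "p(m := ?b)"] exI[of _ "Suc m"]) (auto simp: S_def k 0)
    next
      case (Suc i)
      show ?thesis
      proof (cases "i < n")
        case True
        from ex_extension_not_computing[OF x[OF this], of m p c] show ?thesis
          by (simp add: S_def k Suc True)
      next
        case False
        then show ?thesis
          by (intro exI[of _ p] exI[of _ m]) (simp add: S_def k Suc)
      qed
    qed
  qed
  then obtain q where q: "\<And>k. S k q"
    using baire_category[of S] by blast
  have "\<not> computable (char_fun q)"
  proof
    assume "computable (char_fun q)"
    then obtain c where "\<forall>j. eval (\<lambda>_. 0) c [j] (char_fun q j)"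
      unfolding computable_def by blast
    with q[of "to_nat (c, 0 :: nat)"] show False
      by (simp add: S_def)
  qed
  moreover have "\<not> x i \<le>\<^sub>T char_fun q" if "i < n" for i
  proof
    assume "x i \<le>\<^sub>T char_fun q"
    then obtain c where "\<forall>j. eval (char_fun q) c [j] (x i j)"
      unfolding turing_le_iff by blast
    with q[of "to_nat (c, Suc i)"] that show False
      by (simp add: S_def)
  qed
  ultimately show thesis
    by (rule that)
qed

section \<open>The mass problem\<close>

text \<open>Stage \<open>n\<close> picks \<open>g\<close> above none of the earlier terms;
  \<open>r n\<close> is the noncomputable value of code \<open>n\<close> at \<open>g\<close>, or
  \<open>g\<close> itself if there is none. Either way \<open>r n\<close> is below \<open>g\<close>,
  hence above no earlier term.\<close>

lemma ex_diagonal_sequence: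
  obtains r :: "nat \<Rightarrow> baire" where "\<And>n. \<not> computable (r n)" "\<And>i n. i < n \<Longrightarrow> \<not> r i \<le>\<^sub>T r n"
    "\<And>c. \<exists>g. \<not> computable g \<and> (\<forall>x. (\<forall>k. eval g c [k] (x k)) \<longrightarrow> computable x \<or> x \<in> range r)"
proof -
  \<comment> \<open>\<open>f\<close> supplies the earlier terms; \<open>P\<close> looks at it only
    below \<open>n\<close>, as well-founded choice requires.\<close>
  define P where "P f n r \<longleftrightarrow> \<not> computable r \<and> (\<forall>i<n. \<not> f i \<le>\<^sub>T r) \<and>
    (\<exists>g. \<not> computable g \<and> (\<forall>x. (\<forall>k. eval g (from_nat n) [k] (x k)) \<longrightarrow> computable x \<or> x = r))"
    for f :: "nat \<Rightarrow> baire" and n r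
  have "\<exists>r. \<forall>n. P r n (r n)"
  proof (rule dependent_wf_choice[OF wf_less_than])
    show "P f n r = P g n r" if "\<And>z. (z, n) \<in> less_than \<Longrightarrow> f z = g z" for f g n r
      using that by (simp add: P_def)
  next
    fix n f
    assume IH: "\<And>i. (i, n) \<in> less_than \<Longrightarrow> P f i (f i)"
    then obtain g where g: "\<not> computable g" "\<And>i. i < n \<Longrightarrow> \<not> f i \<le>\<^sub>T g"
      using ex_noncomputable_avoiding_cones[of n f] by (auto simp: P_def)
    show "\<exists>r. P f n r"
    proof (cases "\<exists>x. \<not> computable x \<and> (\<forall>k. eval g (from_nat n) [k] (x k))")
      case True
      then obtain x where x: "\<not> computable x" "\<And>k. eval g (from_nat n) [k] (x k)"
        by blast
      then have "x \<le>\<^sub>T g"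
        unfolding turing_le_iff by blast
      then have "\<forall>i<n. \<not> f i \<le>\<^sub>T x"
        using g(2) turing_le_trans by blast
      moreover have "z = x" if "\<forall>k. eval g (from_nat n) [k] (z k)" for z
        using that x(2) eval_deterministic by blast
      ultimately show ?thesis
        unfolding P_def using x(1) g(1) by blast
    next
      case False
      then show ?thesis
        unfolding P_def using g by blast
    qed
  qed
  then obtain r where r: "\<And>n. P r n (r n)"
    by blast
  show thesis
  proof
    show "\<not> computable (r n)" for n
      using r[of n] by (simp add: P_def)
    show "\<not> r i \<le>\<^sub>T r n" if "i < n" for i n
      using r[of n] that by (simp add: P_def)
    show "\<exists>g. \<not> computable g \<and> (\<forall>x. (\<forall>k. eval g c [k] (x k)) \<longrightarrow> computable x \<or> x \<in> range r)" for c
    proof -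
      obtain g where "\<not> computable g"
        "\<forall>x. (\<forall>k. eval g c [k] (x k)) \<longrightarrow> computable x \<or> x = r (to_nat c)"
        using r[of "to_nat c"] unfolding P_def from_nat_to_nat by blast
      then show ?thesis
        by (intro exI[of _ g]) auto
    qed
  qed
qed

theorem theorem7p6:
  shows "\<exists>\<A> :: mass_problem. noncomputables <\<^sub>M \<A> \<and>
    \<not> (\<exists>f :: baire. \<not> computable f \<and> not_below f \<le>\<^sub>M \<A>)"
proof -
  obtain r :: "nat \<Rightarrow> baire" where r: "\<And>n. \<not> computable (r n)" "\<And>i n. i < n \<Longrightarrow> \<not> r i \<le>\<^sub>T r n"
    "\<And>c. \<exists>g. \<not> computable g \<and> (\<forall>x. (\<forall>k. eval g c [k] (x k)) \<longrightarrow> computable x \<or> x \<in> range r)"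
    by (rule ex_diagonal_sequence) blast
  define A where "A = noncomputables - range r"
  have "noncomputables \<le>\<^sub>M A"
  proof -
    obtain \<Psi> where \<Psi>: "turing_functional \<Psi>" "\<And>f g. \<Psi> f = Some g \<longleftrightarrow> (\<forall>n. eval f Query [n] (g n))"
      using turing_functional_of_code by blast
    then have "\<Psi> f = Some f" for f
      by (auto intro: eval.Query)
    with \<Psi>(1) show ?thesis
      unfolding medvedev_le_def A_def by blast
  qed
  moreover have "\<not> A \<le>\<^sub>M noncomputables"
  proof
    assume "A \<le>\<^sub>M noncomputables"
    then obtain \<Psi> where \<Psi>: "turing_functional \<Psi>" "\<And>g. \<not> computable g \<Longrightarrow> \<exists>x\<in>A. \<Psi> g = Some x"
      unfolding medvedev_le_def noncomputables_def by blast
    then obtain c where c: "\<And>f g. \<Psi> f = Some g \<longleftrightarrow> (\<forall>n. eval f c [n] (g n))"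
      unfolding turing_functional_def by blast
    \<comment> \<open>At this \<open>g\<close> any value of the functional is computable or removed,
      hence outside \<open>A\<close>.\<close>
    obtain g where g: "\<not> computable g"
        "\<And>x. (\<forall>k. eval g c [k] (x k)) \<Longrightarrow> computable x \<or> x \<in> range r"
      using r(3) by blast
    obtain x where "x \<in> A" "\<Psi> g = Some x"
      using \<Psi>(2)[OF g(1)] by blast
    with g(2)[of x] c show False
      by (auto simp: A_def noncomputables_def)
  qed
  moreover have "\<not> not_below f \<le>\<^sub>M A" if f: "\<not> computable f" for f
  proof
    assume "not_below f \<le>\<^sub>M A"
    then obtain \<Psi> where \<Psi>: "turing_functional \<Psi>" "\<And>h. h \<in> A \<Longrightarrow> \<exists>x. \<Psi> h = Some x \<and> \<not> x \<le>\<^sub>T f"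
      unfolding medvedev_le_def not_below_def by blast
    let ?f' = "\<lambda>n. Suc (f n)"
    have f': "\<not> computable ?f'"
      using f computable_if_turing_le turing_le_Suc_comp' by blast
    \<comment> \<open>Otherwise two distinct, Turing equivalent functions would occur in
      \<open>r\<close>, and the later would compute the earlier.\<close>
    have "f \<notin> range r \<or> ?f' \<notin> range r"
    proof (rule ccontr)
      assume "\<not> ?thesis"
      then obtain i j where ij: "r i = f" "r j = ?f'"
        by (auto simp: image_iff)
      then have "r i \<noteq> r j"
        by (metis n_not_Suc_n)
      then have "i < j \<or> j < i"
        using nat_neq_iff by blast
      then show False
        using r(2)[of i j] r(2)[of j i] turing_le_Suc_comp[of f] turing_le_Suc_comp'[of f] ij by auto
    qed
    then obtain h where h: "h \<in> A" "h \<le>\<^sub>T f"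
    proof
      assume "f \<notin> range r"
      moreover have "f \<le>\<^sub>T f"
        using turing_le_Suc_comp turing_le_Suc_comp' turing_le_trans by blast
      ultimately show ?thesis
        using f by (intro that) (auto simp: A_def noncomputables_def)
    next
      assume "?f' \<notin> range r"
      then show ?thesis
        using f' turing_le_Suc_comp by (intro that) (auto simp: A_def noncomputables_def)
    qed
    \<comment> \<open>The value of \<open>\<Psi>\<close> at \<open>h\<close> is below
      \<open>h\<close>, hence below \<open>f\<close>, yet must lie in
      \<open>not_below f\<close>.\<close>
    obtain x where x: "\<Psi> h = Some x" "\<not> x \<le>\<^sub>T f"
      using \<Psi>(2)[OF h(1)] by blast
    then have "x \<le>\<^sub>T h"
      using \<Psi>(1) unfolding turing_le_def by blast
    with h(2) x(2) show False
      using turing_le_trans by blast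
  qed
  ultimately show ?thesis
    unfolding medvedev_less_def by blast
qed

end
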